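(* Let $\tau\in\mathbb{R}\setminus\{0,-1,-2,\dots\}$, let $\hat P=P\Delta^{(\tau)}$ be the product of the Pascal matrix and the fractional difference matrix of order $\tau$, and let $1\le p<\infty$. For each $k\in\mathbb{N}_0=\{0,1,2,\dots\}$ define the sequence $b^{(k)}=(b^{(k)}_n)_{n\in\mathbb{N}_0}$ by $$b^{(k)}_n=\begin{cases}\displaystyle\sum_{j=k}^{n}(-1)^{n-k}\binom{j}{j-k}\frac{\Gamma(-\tau+1)}{(n-j)!\,\Gamma(-\tau-n+j+1)}, & 0\le k\le n,\\[2mm] 0,& k>n.\end{cases}$$ Then $(b^{(k)})_{k\in\mathbb{N}_0}$ is a Schauder basis for $\ell_p(\hat P)$, and each $x\in\ell_p(\hat P)$ has a unique representation $$x=\sum_{k}\mu_k\,b^{(k)},\qquad\text{where }\mu_k=(\hat P x)_k\text{ for each }k\in\mathbb{N}_0,$$ the series converging in the norm of $\ell_p(\hat P)$.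
   Context: $\omega$ denotes the space of all (real or complex) sequences $x=(x_k)_{k\ge 0}$. For real $a$ and integer $m\ge 0$, the expression $\frac{\Gamma(a+1)}{m!\,\Gamma(a-m+1)}$ is understood as the generalized binomial coefficient $\frac{a(a-1)\cdots(a-m+1)}{m!}$ (equal to $1$ for $m=0$). The matrix $\hat P=(\hat p_{nk})_{n,k\ge0}=P\Delta^{(\tau)}$ is lower triangular with $$\hat p_{nk}=\sum_{i=k}^{n}(-1)^{i-k}\binom{n}{n-i}\frac{\Gamma(\tau+1)}{(i-k)!\,\Gamma(\tau-i+k+1)}\quad(0\le k\le n),\qquad \hat p_{nk}=0\quad (k>n).$$ It is the product of the Pascal matrix $P=(\binom{n}{n-k})_{0\le k\le n}$ and the lower triangular matrix $\Delta^{(\tau)}$ with entries $(-1)^{n-k}\frac{\Gamma(\tau+1)}{(n-k)!\,\Gamma(\tau-n+k+1)}$ for $0\le k\le n$. For $x\in\omega$, $(\hat P x)_n=\sum_{k=0}^n\hat p_{nk}x_k$. For $1\le p<\infty$, $\ell_p(\hat P)=\{x\in\omega:\hat P x\in\ell_p\}$ with the norm $\|x\|_{\ell_p(\hat P)}=\|\hat P x\|_{\ell_p}$. *)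

theory Defs
  imports "HOL-Analysis.Analysis"
begin

text \<open>
  Scalars range over an arbitrary type \<open>'a :: real_normed_field\<close>, so both the real and the
  complex sequence spaces are covered. The generalized binomial coefficient
  \<open>\<Gamma>(a+1) / (m! \<Gamma>(a-m+1)) = a(a-1)\<dots>(a-m+1) / m!\<close> is \<open>a gchoose m\<close>; this is also its meaning
  where the Gamma quotient is singular (\<open>a\<close> a negative integer), which does occur below.
\<close>

definition pascal :: "nat \<Rightarrow> nat \<Rightarrow> real" where
  "pascal n k = (if k \<le> n then real (n choose (n - k)) else 0)"

definition frac_diff :: "real \<Rightarrow> nat \<Rightarrow> nat \<Rightarrow> real" where
  "frac_diff \<tau> n k = (if k \<le> n then (-1) ^ (n - k) * (\<tau> gchoose (n - k)) else 0)"

definition hatP :: "real \<Rightarrow> nat \<Rightarrow> nat \<Rightarrow> real" where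
  "hatP \<tau> n k =
     (if k \<le> n
      then (\<Sum>i=k..n. (-1) ^ (i - k) * real (n choose (n - i)) * (\<tau> gchoose (i - k)))
      else 0)"

lemma hatP_eq_product: "hatP \<tau> n k = (\<Sum>i\<le>n. pascal n i * frac_diff \<tau> i k)"
proof -
  have "(\<Sum>i\<le>n. pascal n i * frac_diff \<tau> i k) = (\<Sum>i\<in>{k..n}. pascal n i * frac_diff \<tau> i k)"
    by (rule sum.mono_neutral_right) (auto simp: frac_diff_def)
  also have "\<dots> = hatP \<tau> n k"
    by (auto simp: hatP_def pascal_def frac_diff_def mult_ac intro!: sum.cong)
  finally show ?thesis by simp
qed

definition hatP_transform :: "real \<Rightarrow> (nat \<Rightarrow> 'a::real_normed_field) \<Rightarrow> nat \<Rightarrow> 'a" where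
  "hatP_transform \<tau> x n = (\<Sum>k\<le>n. of_real (hatP \<tau> n k) * x k)"

definition lp_space :: "real \<Rightarrow> (nat \<Rightarrow> 'a::real_normed_field) set" where
  "lp_space p = {x. summable (\<lambda>n. norm (x n) powr p)}"

text \<open>Only meaningful on \<open>lp_space p\<close>; outside, the infinite sum is unspecified.\<close>

definition lp_norm :: "real \<Rightarrow> (nat \<Rightarrow> 'a::real_normed_field) \<Rightarrow> real" where
  "lp_norm p x = (\<Sum>n. norm (x n) powr p) powr (1 / p)"

definition lp_hatP :: "real \<Rightarrow> real \<Rightarrow> (nat \<Rightarrow> 'a::real_normed_field) set" where
  "lp_hatP \<tau> p = {x. hatP_transform \<tau> x \<in> lp_space p}"

definition lp_hatP_norm :: "real \<Rightarrow> real \<Rightarrow> (nat \<Rightarrow> 'a::real_normed_field) \<Rightarrow> real" where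
  "lp_hatP_norm \<tau> p x = lp_norm p (hatP_transform \<tau> x)"

text \<open>
  \<open>expands N b \<alpha> x\<close> says that \<open>x = (\<Sum>k. \<alpha> k \<cdot> b k)\<close> with the series converging in the norm \<open>N\<close>,
  where \<open>b k\<close> is itself a sequence and the partial sums are formed coordinatewise.
\<close>

definition expands ::
  "((nat \<Rightarrow> 'a::real_normed_field) \<Rightarrow> real) \<Rightarrow> (nat \<Rightarrow> nat \<Rightarrow> 'a) \<Rightarrow> (nat \<Rightarrow> 'a) \<Rightarrow> (nat \<Rightarrow> 'a) \<Rightarrow> bool"
where
  "expands N b \<alpha> x \<longleftrightarrow> (\<lambda>m. N (\<lambda>n. x n - (\<Sum>k\<le>m. \<alpha> k * b k n))) \<longlonglongrightarrow> 0"

text \<open>\<open>X\<close> is intended to be a linear space of sequences and \<open>N\<close> a norm on it.\<close>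

definition schauder_basis ::
  "(nat \<Rightarrow> 'a::real_normed_field) set \<Rightarrow> ((nat \<Rightarrow> 'a) \<Rightarrow> real) \<Rightarrow> (nat \<Rightarrow> nat \<Rightarrow> 'a) \<Rightarrow> bool"
where
  "schauder_basis X N b \<longleftrightarrow> (\<forall>k. b k \<in> X) \<and> (\<forall>x\<in>X. \<exists>!\<alpha>. expands N b \<alpha> x)"

definition basis_seq :: "real \<Rightarrow> nat \<Rightarrow> nat \<Rightarrow> 'a::real_normed_field" where
  "basis_seq \<tau> k n =
     (if k \<le> n
      then of_real (\<Sum>j=k..n. (-1) ^ (n - k) * real (j choose (j - k)) * ((-\<tau>) gchoose (n - j)))
      else 0)"

end

theory Submission
  imports Defs
begin

text \<open>
  Since \<open>P\<inverse>\<close> is the signed Pascal matrix and \<open>\<Delta>\<^sup>(\<^sup>\<tau>\<^sup>)\<close> has inverse \<open>\<Delta>\<^sup>(\<^sup>-\<^sup>\<tau>\<^sup>)\<close>, the sequence \<open>b\<^sup>(\<^sup>k\<^sup>)\<close> is the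
  \<open>k\<close>-th column of the inverse of the matrix of the transform, so the transform is a norm-preserving
  map sending \<open>b\<^sup>(\<^sup>k\<^sup>)\<close> to the \<open>k\<close>-th unit vector. The claim thus reduces to the fact
  that the unit vectors form a Schauder basis of \<open>\<ell>\<^sub>p\<close>.
\<close>

definition signed_pascal :: "nat \<Rightarrow> nat \<Rightarrow> real" where
  "signed_pascal n k = (if k \<le> n then (-1) ^ (n - k) * real (n choose k) else 0)"

text \<open>Trinomial revision takes the factor \<open>n choose k\<close> out of each term. What
  remains is the alternating sum of row \<open>n - k\<close> of Pascal's triangle, which vanishes
  unless that row is row 0.\<close>

lemma pascal_signed_pascal:
  "(\<Sum>i\<le>n. pascal n i * signed_pascal i k) = of_bool (n = k)"
proof (cases "k \<le> n")
  case True
  have "(\<Sum>i\<le>n. pascal n i * signed_pascal i k) = (\<Sum>i\<in>{k..n}. pascal n i * signed_pascal i k)"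
    by (rule sum.mono_neutral_right) (auto simp: signed_pascal_def)
  \<comment> \<open>Both bounds are written as shifts by \<open>k\<close> so that the reindexing
    rule matches syntactically.\<close>
  also have "\<dots> = (\<Sum>i=0+k..(n-k)+k. pascal n i * signed_pascal i k)"
    using True by simp
  also have "\<dots> = (\<Sum>i\<le>n-k. pascal n (i + k) * signed_pascal (i + k) k)"
    by (subst sum.shift_bounds_cl_nat_ivl) (simp add: atMost_atLeast0)
  also have "\<dots> = (\<Sum>i\<le>n-k. real (n choose k) * ((-1) ^ i * real (n - k choose i)))"
  proof (rule sum.cong[OF refl])
    fix i assume "i \<in> {..n - k}"
    hence i: "i + k \<le> n" using True by simp
    have "(n choose (i + k)) * (i + k choose k) = (n choose k) * (n - k choose i)"
      using choose_mult[of k "i + k" n] i by simp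
    then have "real (n choose (i + k)) * real (i + k choose k) = real (n choose k) * real (n - k choose i)"
      by (metis of_nat_mult)
    then show "pascal n (i + k) * signed_pascal (i + k) k = real (n choose k) * ((-1) ^ i * real (n - k choose i))"
      using i binomial_symmetric[OF i] by (simp add: pascal_def signed_pascal_def mult_ac)
  qed
  also have "\<dots> = real (n choose k) * (\<Sum>i\<le>n-k. (-1) ^ i * real (n - k choose i))"
    by (simp add: sum_distrib_left)
  also have "\<dots> = of_bool (n = k)"
    using True choose_alternating_sum[of "n - k", where 'a = real] by (cases "n = k") auto
  finally show ?thesis .
next
  case False
  then show ?thesis by (auto simp: signed_pascal_def intro!: sum.neutral)
qed

text \<open>The signs combine to a constant, and Vandermonde's convolution turns the sum into
  \<open>(- \<tau> + \<tau>) gchoose (i - j)\<close>, which is 0 unless \<open>i = j\<close>.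
  Summing up to any \<open>n \<ge> i\<close> gives all indices a common range, so that sums can
  later be interchanged.\<close>

lemma frac_diff_mult_uminus:
  assumes "i \<le> n"
  shows "(\<Sum>l\<le>n. frac_diff \<tau> i l * frac_diff (- \<tau>) l j) = of_bool (i = j)"
proof (cases "j \<le> i")
  case True
  have "(\<Sum>l\<le>n. frac_diff \<tau> i l * frac_diff (- \<tau>) l j) = (\<Sum>l\<in>{j..i}. frac_diff \<tau> i l * frac_diff (- \<tau>) l j)"
    using assms by (intro sum.mono_neutral_right) (auto simp: frac_diff_def)
  also have "\<dots> = (\<Sum>l=0+j..(i-j)+j. frac_diff \<tau> i l * frac_diff (- \<tau>) l j)"
    using True by simp
  also have "\<dots> = (\<Sum>m=0..i-j. frac_diff \<tau> i (m + j) * frac_diff (- \<tau>) (m + j) j)"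
    by (rule sum.shift_bounds_cl_nat_ivl)
  also have "\<dots> = (\<Sum>m=0..i-j. (-1) ^ (i - j) * ((- \<tau> gchoose m) * (\<tau> gchoose (i - j - m))))"
  proof (rule sum.cong[OF refl])
    fix m assume "m \<in> {0..i - j}"
    hence m: "m + j \<le> i" using True by simp
    hence "(-1 :: real) ^ (i - j) = (-1) ^ (i - (m + j)) * (-1) ^ m"
      by (simp flip: power_add)
    with m show "frac_diff \<tau> i (m + j) * frac_diff (- \<tau>) (m + j) j
        = (-1) ^ (i - j) * ((- \<tau> gchoose m) * (\<tau> gchoose (i - j - m)))"
      by (simp add: frac_diff_def add.commute)
  qed
  also have "\<dots> = (-1) ^ (i - j) * ((- \<tau> + \<tau>) gchoose (i - j))"
    by (simp only: gbinomial_Vandermonde flip: sum_distrib_left)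
  also have "\<dots> = of_bool (i = j)"
    using True by (cases "i = j") (auto simp: gbinomial_0_left)
  finally show ?thesis .
next
  case False
  then show ?thesis by (auto simp: frac_diff_def intro!: sum.neutral)
qed

text \<open>Column \<open>k\<close> of the inverse, factored in the order opposite to
  \<open>hatP\<close>. Terms with \<open>j > l\<close> vanish by triangularity, so the range may
  again be extended to a common \<open>n\<close>.\<close>

lemma basis_seq_eq_product:
  assumes "l \<le> n"
  shows "(basis_seq \<tau> k l :: 'a::real_normed_field)
    = of_real (\<Sum>j\<le>n. frac_diff (- \<tau>) l j * signed_pascal j k)"
proof (cases "k \<le> l")
  case True
  have "(\<Sum>j\<le>n. frac_diff (- \<tau>) l j * signed_pascal j k)
      = (\<Sum>j\<in>{k..l}. frac_diff (- \<tau>) l j * signed_pascal j k)"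
    using assms by (intro sum.mono_neutral_right) (auto simp: frac_diff_def signed_pascal_def)
  also have "\<dots> = (\<Sum>j=k..l. (-1) ^ (l - k) * real (j choose (j - k)) * ((-\<tau>) gchoose (l - j)))"
  proof (rule sum.cong[OF refl])
    fix j assume "j \<in> {k..l}"
    hence j: "k \<le> j" "j \<le> l" by auto
    hence "(-1 :: real) ^ (l - k) = (-1) ^ (l - j) * (-1) ^ (j - k)"
      by (simp flip: power_add)
    with j binomial_symmetric[OF j(1)]
    show "frac_diff (- \<tau>) l j * signed_pascal j k
        = (-1) ^ (l - k) * real (j choose (j - k)) * ((-\<tau>) gchoose (l - j))"
      by (simp add: frac_diff_def signed_pascal_def)
  qed
  finally show ?thesis using True by (simp add: basis_seq_def)
next
  case False
  then have "(\<Sum>j\<le>n. frac_diff (- \<tau>) l j * signed_pascal j k) = 0"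
    by (auto simp: frac_diff_def signed_pascal_def intro!: sum.neutral)
  with False show ?thesis by (simp add: basis_seq_def)
qed

text \<open>This is associativity for the four triangular factors, truncated at \<open>n\<close>:
  the two inner difference matrices cancel first, then the two outer Pascal matrices.\<close>

lemma hatP_transform_basis_seq:
  "hatP_transform \<tau> (basis_seq \<tau> k :: nat \<Rightarrow> 'a::real_normed_field) n = of_bool (n = k)"
proof -
  have "(\<Sum>l\<le>n. hatP \<tau> n l * (\<Sum>j\<le>n. frac_diff (- \<tau>) l j * signed_pascal j k))
      = (\<Sum>l\<le>n. \<Sum>i\<le>n. \<Sum>j\<le>n. pascal n i * (frac_diff \<tau> i l * frac_diff (- \<tau>) l j) * signed_pascal j k)"
    by (simp add: hatP_eq_product sum_product mult_ac)
  also have "\<dots> = (\<Sum>i\<le>n. \<Sum>j\<le>n. \<Sum>l\<le>n. pascal n i * (frac_diff \<tau> i l * frac_diff (- \<tau>) l j) * signed_pascal j k)"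
    \<comment> \<open>Two interchanges, \<open>l\<close> with \<open>i\<close> and then
      \<open>l\<close> with \<open>j\<close>, make the sum over \<open>l\<close> innermost.\<close>
    by (subst sum.swap, rule sum.cong[OF refl], rule sum.swap)
  also have "\<dots> = (\<Sum>i\<le>n. \<Sum>j\<le>n. pascal n i * of_bool (i = j) * signed_pascal j k)"
    by (intro sum.cong refl)
       (simp add: frac_diff_mult_uminus flip: sum_distrib_left sum_distrib_right)
  also have "\<dots> = (\<Sum>i\<le>n. pascal n i * signed_pascal i k)"
  proof (rule sum.cong[OF refl])
    fix i assume "i \<in> {..n}"
    have "(\<Sum>j\<le>n. pascal n i * of_bool (i = j) * signed_pascal j k)
        = (\<Sum>j\<le>n. if i = j then pascal n i * signed_pascal j k else 0)"
      by (intro sum.cong) auto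
    with \<open>i \<in> {..n}\<close> show "(\<Sum>j\<le>n. pascal n i * of_bool (i = j) * signed_pascal j k) = pascal n i * signed_pascal i k"
      by simp
  qed
  finally have *: "(\<Sum>l\<le>n. hatP \<tau> n l * (\<Sum>j\<le>n. frac_diff (- \<tau>) l j * signed_pascal j k)) = of_bool (n = k)"
    by (simp add: pascal_signed_pascal)
  have "hatP_transform \<tau> (basis_seq \<tau> k :: nat \<Rightarrow> 'a) n
      = of_real (\<Sum>l\<le>n. hatP \<tau> n l * (\<Sum>j\<le>n. frac_diff (- \<tau>) l j * signed_pascal j k))"
    unfolding hatP_transform_def of_real_sum of_real_mult
    by (intro sum.cong refl) (simp add: basis_seq_eq_product[where n = n])
  with * show ?thesis by simp
qed

lemma hatP_transform_diff:
  "hatP_transform \<tau> (\<lambda>n. x n - y n) n = hatP_transform \<tau> x n - hatP_transform \<tau> y n"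
  by (simp add: hatP_transform_def right_diff_distrib sum_subtractf)

lemma hatP_transform_lincomb:
  "hatP_transform \<tau> (\<lambda>n. \<Sum>k\<in>A. c k * b k n) n = (\<Sum>k\<in>A. c k * hatP_transform \<tau> (b k) n)"
  unfolding hatP_transform_def sum_distrib_left
  by (subst sum.swap) (simp add: mult_ac)

text \<open>On the transform side the basis consists of unit vectors, so subtracting a partial sum
  only affects coordinates up to \<open>m\<close>.\<close>

lemma hatP_transform_remainder:
  "hatP_transform \<tau> (\<lambda>n. x n - (\<Sum>k\<le>m. \<mu> k * basis_seq \<tau> k n)) n
    = hatP_transform \<tau> x n - (if n \<le> m then \<mu> n else 0)"
proof -
  have "(\<Sum>k\<le>m. \<mu> k * of_bool (n = k)) = (\<Sum>k\<le>m. if n = k then \<mu> k else 0)"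
    by (intro sum.cong) auto
  then show ?thesis
    by (simp add: hatP_transform_diff hatP_transform_lincomb hatP_transform_basis_seq)
qed

lemma lp_norm_tail_tendsto_0:
  fixes y :: "nat \<Rightarrow> 'a::real_normed_field"
  assumes "p > 0" "y \<in> lp_space p"
  shows "(\<lambda>m. lp_norm p (\<lambda>n. y n - (if n \<le> m then y n else 0))) \<longlonglongrightarrow> 0"
proof -
  define f where "f n = norm (y n) powr p" for n
  have f: "summable f" using assms(2) by (simp add: lp_space_def f_def[abs_def])
  have tail: "(\<Sum>n. norm (y n - (if n \<le> m then y n else 0)) powr p) = suminf f - sum f {..m}" for m
  proof -
    have "(\<lambda>n. if n \<in> {..m} then f n else 0) sums sum f {..m}"
      by (rule sums_If_finite_set) simp
    from sums_diff[OF summable_sums[OF f] this]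
    have "(\<lambda>n. norm (y n - (if n \<le> m then y n else 0)) powr p) sums (suminf f - sum f {..m})"
      by (rule sums_cong[THEN iffD1, rotated]) (auto simp: f_def)
    then show ?thesis by (simp add: sums_iff)
  qed
  have "(\<lambda>m. suminf f - sum f {..m}) \<longlonglongrightarrow> suminf f - suminf f"
    by (intro tendsto_intros summable_LIMSEQ' f)
  \<comment> \<open>At the limit base 0, continuity of \<open>powr\<close> requires a nonnegative
    base and a positive exponent.\<close>
  moreover have "suminf f - sum f {..m} \<ge> 0" for m
    using sum_le_suminf[OF f, of "{..m}"] by (simp add: f_def)
  ultimately have "(\<lambda>m. (suminf f - sum f {..m}) powr (1 / p)) \<longlonglongrightarrow> 0 powr (1 / p)"
    using assms(1) by (intro tendsto_powr') auto
  then show ?thesis by (simp add: lp_norm_def tail)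
qed

text \<open>Boundedness of the coordinate functionals, which forces uniqueness of the
  coefficients.\<close>

lemma norm_le_lp_norm:
  assumes "p > 0" "y \<in> lp_space p"
  shows "norm (y n) \<le> lp_norm p y"
proof -
  have "norm (y n) powr p \<le> (\<Sum>n. norm (y n) powr p)"
    using sum_le_suminf[of "\<lambda>n. norm (y n) powr p" "{n}"] assms(2) by (simp add: lp_space_def)
  then have "(norm (y n) powr p) powr (1 / p) \<le> lp_norm p y"
    unfolding lp_norm_def using assms(1) by (intro powr_mono2) auto
  then show ?thesis using assms(1) by (simp add: powr_powr)
qed

lemma lp_space_cong_tail:
  assumes "\<And>n. n > m \<Longrightarrow> y n = z n" "y \<in> lp_space p"
  shows "z \<in> lp_space p"
proof -
  have "eventually (\<lambda>n. norm (y n) powr p = norm (z n) powr p) sequentially"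
    using eventually_gt_at_top[of m] by eventually_elim (simp add: assms(1))
  from summable_cong[OF this] assms(2) show ?thesis by (simp add: lp_space_def)
qed

lemma expands_basis_seq_iff:
  fixes x :: "nat \<Rightarrow> 'a::real_normed_field"
  assumes "p > 0" "x \<in> lp_hatP \<tau> p"
  shows "expands (lp_hatP_norm \<tau> p) (basis_seq \<tau>) \<mu> x \<longleftrightarrow> \<mu> = hatP_transform \<tau> x"
proof -
  define y where "y = hatP_transform \<tau> x"
  have y: "y \<in> lp_space p" using assms(2) by (simp add: lp_hatP_def y_def)
  let ?r = "\<lambda>m n. y n - (if n \<le> m then \<mu> n else 0)"
  have expands_iff: "expands (lp_hatP_norm \<tau> p) (basis_seq \<tau>) \<mu> x \<longleftrightarrow> (\<lambda>m. lp_norm p (?r m)) \<longlonglongrightarrow> 0"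
    unfolding expands_def lp_hatP_norm_def y_def by (simp add: hatP_transform_remainder[abs_def])
  have "\<mu> = y" if lim: "(\<lambda>m. lp_norm p (?r m)) \<longlonglongrightarrow> 0"
  proof
    fix n
    \<comment> \<open>From \<open>m = n\<close> on, coordinate \<open>n\<close> of the remainder no
      longer depends on \<open>m\<close>, so the vanishing norms bound a fixed number.\<close>
    have bound: "norm (y n - \<mu> n) \<le> lp_norm p (?r m)" if "n \<le> m" for m
    proof -
      \<comment> \<open>Membership is needed here because \<open>lp_norm\<close> carries no
        information for a divergent sum. The remainder differs from \<open>y\<close> in finitely
        many coordinates only.\<close>
      have "?r m \<in> lp_space p" by (rule lp_space_cong_tail[OF _ y, of m]) simp
      from norm_le_lp_norm[OF assms(1) this, of n] that show ?thesis by simp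
    qed
    have "norm (y n - \<mu> n) \<le> 0"
      by (rule tendsto_lowerbound[OF lim])
         (use bound in \<open>auto intro: eventually_sequentiallyI[of n]\<close>)
    then show "\<mu> n = y n" by simp
  qed
  moreover have "(\<lambda>m. lp_norm p (?r m)) \<longlonglongrightarrow> 0" if "\<mu> = y"
    unfolding that by (rule lp_norm_tail_tendsto_0[OF assms(1) y])
  ultimately show ?thesis unfolding expands_iff y_def by blast
qed

lemma basis_seq_in_lp_hatP: "basis_seq \<tau> k \<in> lp_hatP \<tau> p"
proof -
  have "(\<lambda>n. 0) \<in> lp_space p" by (simp add: lp_space_def)
  then have "hatP_transform \<tau> (basis_seq \<tau> k) \<in> lp_space p"
    by (rule lp_space_cong_tail[of k, rotated]) (simp add: hatP_transform_basis_seq)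
  then show ?thesis by (simp add: lp_hatP_def)
qed

theorem theorem5p1:
  fixes \<tau> p :: real
  assumes "\<tau> \<notin> \<int>\<^sub>\<le>\<^sub>0" and "1 \<le> p"
  shows "schauder_basis (lp_hatP \<tau> p :: (nat \<Rightarrow> 'a::real_normed_field) set)
           (lp_hatP_norm \<tau> p) (basis_seq \<tau>) \<and>
         (\<forall>x \<in> (lp_hatP \<tau> p :: (nat \<Rightarrow> 'a) set). \<forall>\<mu>.
            expands (lp_hatP_norm \<tau> p) (basis_seq \<tau>) \<mu> x \<longleftrightarrow> \<mu> = hatP_transform \<tau> x)"
proof -
  have "p > 0" using assms(2) by simp
  \<comment> \<open>The equivalence pins down the coefficients completely, giving both halves of the
    unique existence as well as the explicit formula.\<close>
  then show ?thesis
    by (simp add: schauder_basis_def basis_seq_in_lp_hatP expands_basis_seq_iff)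
qed

end
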